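(* For all $n\geq1$, $$Y_n(a,p,q,y,t)=X_n(a,1,1,1,p,q,y,t),$$ that is, $$\sum_{\sigma\in\mathcal Y^*_{2n+1}}a^{\mathrm{lema}\,\sigma}p^{(2\text{-}13)\sigma}q^{(31\text{-}2)\sigma}y^{\mathrm{dd}\,\sigma}t^{\mathrm{des}\,\sigma}=\sum_{\sigma\in\mathcal X_{2n}}a^{\mathrm{lema}\,\sigma}p^{(2\text{-}31)\sigma}q^{(31\text{-}2)\sigma}y^{\mathrm{dom}\,\sigma}t^{\mathrm{des}\,\sigma}.$$
   Context: Permutations $\sigma\in\mathfrak S_m$ of $[m]=\{1,\dots,m\}$ are written as words $\sigma_1\cdots\sigma_m$. A descent of $\sigma$ is a pair $(\sigma_i,\sigma_{i+1})$, $1\le i\le m-1$, with $\sigma_i>\sigma_{i+1}$; $\sigma_i$ is the descent top, $\sigma_{i+1}$ the descent bottom; $\mathrm{des}\,\sigma$ is the number of descents. $\mathcal X_{2n}$ is the set of $\sigma\in\mathfrak S_{2n}$ such that every descent has even top and odd bottom. $\mathcal Y^*_{2n+1}$ is the set of $\sigma\in\mathfrak S_{2n+1}$ such that every descent has odd top and odd bottom, and such that the last letter $\sigma_{2n+1}$ is odd. $\mathrm{lema}\,\sigma$ is the number of even left-to-right maxima, i.e. of even values $\sigma_i$ with $\sigma_j<\sigma_i$ for all $j<i$. For $\sigma\in\mathcal X_{2n}$, $\mathrm{dom}(\sigma)$ is the number of $j\in[n]$ such that $2j$ is a descent top and $2j-1$ is a descent bottom of $\sigma$ (not necessarily of the same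 descent). With the convention $\sigma_0=\sigma_{m+1}=0$ for $\sigma\in\mathfrak S_m$, $\mathrm{dd}\,\sigma$ is the number of double descents, i.e. of $i\in[m]$ with $\sigma_{i-1}>\sigma_i>\sigma_{i+1}$. For $\sigma\in\mathfrak S_m$: $(31\text{-}2)\sigma$ is the number of pairs $(i,j)$ with $2\le i<j\le m$ and $\sigma_{i-1}>\sigma_j>\sigma_i$; $(2\text{-}31)\sigma$ is the number of pairs $(i,j)$ with $1\le i<j\le m-1$ and $\sigma_j>\sigma_i>\sigma_{j+1}$; $(2\text{-}13)\sigma$ is the number of pairs $(i,j)$ with $1\le i<j\le m-1$ and $\sigma_{j+1}>\sigma_i>\sigma_j$. *)

theory Defs
  imports Main "HOL-Combinatorics.Permutations"
begin

text \<open>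
  A permutation of \<open>{1..m}\<close> is a function \<open>s :: nat \<Rightarrow> nat\<close> with \<open>s permutes {1..m}\<close>;
  its word is \<open>s 1, \<dots>, s m\<close>. As \<open>s\<close> does not determine \<open>m\<close>, the length is an explicit argument
  of the definitions that need it.
\<close>

definition descents :: "nat \<Rightarrow> (nat \<Rightarrow> nat) \<Rightarrow> (nat \<times> nat) set" where
  "descents m s = {(s i, s (i + 1)) | i. 1 \<le> i \<and> i < m \<and> s i > s (i + 1)}"

definition descent_tops :: "nat \<Rightarrow> (nat \<Rightarrow> nat) \<Rightarrow> nat set" where
  "descent_tops m s = fst ` descents m s"

definition descent_bottoms :: "nat \<Rightarrow> (nat \<Rightarrow> nat) \<Rightarrow> nat set" where
  "descent_bottoms m s = snd ` descents m s"

definition des :: "nat \<Rightarrow> (nat \<Rightarrow> nat) \<Rightarrow> nat" where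
  "des m s = card (descents m s)"

definition X_perms :: "nat \<Rightarrow> (nat \<Rightarrow> nat) set" where
  "X_perms n = {s. s permutes {1..2 * n} \<and>
     (\<forall>(x, y) \<in> descents (2 * n) s. even x \<and> odd y)}"

definition Y_star_perms :: "nat \<Rightarrow> (nat \<Rightarrow> nat) set" where
  "Y_star_perms n = {s. s permutes {1..2 * n + 1} \<and>
     (\<forall>(x, y) \<in> descents (2 * n + 1) s. odd x \<and> odd y) \<and> odd (s (2 * n + 1))}"

definition lema :: "nat \<Rightarrow> (nat \<Rightarrow> nat) \<Rightarrow> nat" where
  "lema m s = card {s i | i. 1 \<le> i \<and> i \<le> m \<and> even (s i) \<and> (\<forall>j. 1 \<le> j \<and> j < i \<longrightarrow> s j < s i)}"

text \<open>Here the permutation has length \<open>2 * n\<close>.\<close>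

definition dom_count :: "nat \<Rightarrow> (nat \<Rightarrow> nat) \<Rightarrow> nat" where
  "dom_count n s = card {j. 1 \<le> j \<and> j \<le> n \<and>
     2 * j \<in> descent_tops (2 * n) s \<and> 2 * j - 1 \<in> descent_bottoms (2 * n) s}"

text \<open>
  The boundary convention \<open>s 0 = s (m + 1) = 0\<close> must be imposed explicitly, since
  \<open>s permutes {1..m}\<close> gives \<open>s (m + 1) = m + 1\<close>.
\<close>

definition pad :: "nat \<Rightarrow> (nat \<Rightarrow> nat) \<Rightarrow> nat \<Rightarrow> nat" where
  "pad m s i = (if 1 \<le> i \<and> i \<le> m then s i else 0)"

definition dd :: "nat \<Rightarrow> (nat \<Rightarrow> nat) \<Rightarrow> nat" where
  "dd m s = card {i. 1 \<le> i \<and> i \<le> m \<and> pad m s (i - 1) > pad m s i \<and> pad m s i > pad m s (i + 1)}"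

definition pat_31_2 :: "nat \<Rightarrow> (nat \<Rightarrow> nat) \<Rightarrow> nat" where
  "pat_31_2 m s = card {(i, j). 2 \<le> i \<and> i < j \<and> j \<le> m \<and> s (i - 1) > s j \<and> s j > s i}"

definition pat_2_31 :: "nat \<Rightarrow> (nat \<Rightarrow> nat) \<Rightarrow> nat" where
  "pat_2_31 m s = card {(i, j). 1 \<le> i \<and> i < j \<and> j + 1 \<le> m \<and> s j > s i \<and> s i > s (j + 1)}"

definition pat_2_13 :: "nat \<Rightarrow> (nat \<Rightarrow> nat) \<Rightarrow> nat" where
  "pat_2_13 m s = card {(i, j). 1 \<le> i \<and> i < j \<and> j + 1 \<le> m \<and> s (j + 1) > s i \<and> s i > s j}"

end

theory Submission
  imports Defs
begin

text \<open>
  Both sides satisfy the same recursion when permutations are built by inserting their letters in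
  increasing order.

  Put \<open>N = 2 * n + 1\<close> and look at a permutation of \<open>{1..N}\<close> through its letters \<open>\<le> k\<close>: every maximal
  run of larger letters is shrunk to a single hole, for which the symbol \<open>N\<close> is used. Such a
  configuration at stage \<open>k + 1\<close> arises from exactly one configuration at stage \<open>k\<close>, one hole of it,
  and two bits: the hole is replaced by the letter \<open>k + 1\<close>, and a hole may survive to the left and to
  the right of the new letter (\<open>bij_betw_fill\<close>). The left bit says that \<open>k + 1\<close> will be preceded by a
  larger letter, that is, will be a descent bottom; the right bit says that it will be followed by a
  larger letter.

  The statistics are sums over letters of quantities that are decided when the letter is inserted:
  later insertions only change the holes, which stand for larger letters (\<open>stats_fill\<close>). If the chosen hole has \<open>i\<close>
  holes to its left and \<open>c\<close> to its right, the new letter is the 2 of exactly \<open>i\<close> patterns 31-2, because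
  every hole to the left is followed by a small letter, and likewise the 2 of exactly \<open>c\<close> patterns
  2-13; it is a left-to-right maximum iff \<open>i = 0\<close> and no hole survives on its left. In a word that ends
  with a hole, it is the 2 of \<open>c\<close> patterns 2-31, or of \<open>c - 1\<close> if it is a descent top
  (\<open>stats_new\<close>). Hence only the number \<open>r\<close> of holes matters, and the sum over the chosen hole gives
  \<open>[r] = (\<Sum>i<r. q ^ i * p ^ (r - 1 - i))\<close>, or \<open>[r]\<^sub>a\<close>, the same sum with the term \<open>i = 0\<close> multiplied
  by \<open>a\<close>, when the letter is even.

  A permutation in \<open>X_perms n\<close> fixes \<open>N\<close>, so it gives a word ending with a hole. Its odd letters must be
  followed by a larger letter and its even letters must not be preceded by one: an odd letter keeps or
  raises \<open>r\<close>, an even letter keeps or lowers it. In \<open>Y_star_perms n\<close> the even letters must be preceded by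
  a smaller and followed by a larger letter, so they keep \<open>r\<close>, and the odd letters are free. Counting
  descents by their bottoms, the insertion of \<open>2 * j + 1\<close> and \<open>2 * j + 2\<close> has in both cases the total
  weight
    \<open>t * [r] * [r + 1]\<^sub>a\<close> for \<open>r \<mapsto> r + 1\<close>, \<open>(1 + y * t) * [r] * [r]\<^sub>a\<close> for \<open>r \<mapsto> r\<close>,
    and \<open>[r] * [r - 1]\<^sub>a\<close> for \<open>r \<mapsto> r - 1\<close>.
  For \<open>r \<mapsto> r\<close> the term \<open>y * t\<close> stands on one side for an odd double descent, on the other for a descent
  bottom \<open>2 * j + 1\<close> followed in value by a descent top \<open>2 * j + 2\<close>. So the two weighted sums over all
  configurations with a given number of holes agree at every even stage
  (\<open>sum_X_total_eq_sum_Y_total\<close>). At stage \<open>2 * n\<close> the configurations with one hole are the words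
  of the permutations of \<open>{1..N}\<close>, the hole now being the letter \<open>N\<close> itself, and this is the theorem.
\<close>

section \<open>Configurations of small letters and holes\<close>

text \<open>
  A hole is the letter \<open>N\<close>, assumed larger than all letters inserted so far, so that comparisons with a
  hole need no special treatment and the finished words are ordinary permutation words.
\<close>

definition configs :: "nat \<Rightarrow> nat \<Rightarrow> nat list set" where
  "configs N k = {w. set w - {N} = {1..k} \<and> distinct (filter (\<lambda>x. x \<noteq> N) w) \<and>
     successively (\<lambda>x y. \<not> (x = N \<and> y = N)) w}"

definition fill :: "nat \<Rightarrow> nat \<Rightarrow> bool \<Rightarrow> bool \<Rightarrow> nat list" where
  "fill N v b c = (if b then [N] else []) @ v # (if c then [N] else [])"

definition holes :: "nat \<Rightarrow> nat list \<Rightarrow> (nat list \<times> nat list) set" where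
  "holes N w = {(u, v). w = u @ N # v}"

lemma configsD:
  assumes "u @ N # v \<in> configs N k"
  shows "u \<noteq> [] \<Longrightarrow> last u \<noteq> N" "v \<noteq> [] \<Longrightarrow> hd v \<noteq> N"
    "set u \<subseteq> {1..k} \<union> {N}" "set v \<subseteq> {1..k} \<union> {N}"
  using assms by (auto simp: configs_def successively_append_iff successively_Cons)

text \<open>
  The two cancellation lemmas recover the bits of an insertion from the finished word: as no two holes
  are adjacent, a hole next to the new letter can only be one that survived the insertion.
\<close>

lemma append_optional_last_cancel:
  assumes "u @ (if b then [N] else []) = u' @ (if b' then [N] else [])"
    and "u \<noteq> [] \<Longrightarrow> last u \<noteq> N" "u' \<noteq> [] \<Longrightarrow> last u' \<noteq> N"
  shows "u = u' \<and> b = b'"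
  using assms by (cases b; cases b'; auto simp: last_append split: if_splits) 

lemma prepend_optional_hd_cancel:
  assumes "(if b then [N] else []) @ v = (if b' then [N] else []) @ v'"
    and "v \<noteq> [] \<Longrightarrow> hd v \<noteq> N" "v' \<noteq> [] \<Longrightarrow> hd v' \<noteq> N"
  shows "v = v' \<and> b = b'"
  using assms by (cases b; cases b'; auto split: if_splits) 

text \<open>
  The inverse replaces the largest letter, together with the holes next to it, by one hole.
\<close>

lemma bij_betw_fill:
  assumes "Suc k < N"
  shows "bij_betw (\<lambda>((u, v), (b, c)). u @ fill N (Suc k) b c @ v)
           ({(u, v). u @ N # v \<in> configs N k} \<times> UNIV) (configs N (Suc k))"
  unfolding bij_betw_def
proof
  have fresh: "Suc k \<notin> set u" "Suc k \<notin> set v" if "u @ N # v \<in> configs N k" for u v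
    using configsD(3,4)[OF that] assms by auto
  show "inj_on (\<lambda>((u, v), (b, c)). u @ fill N (Suc k) b c @ v)
          ({(u, v). u @ N # v \<in> configs N k} \<times> UNIV)"
  proof (clarsimp simp: inj_on_def)
    fix u v b c u' v' b' c'
    assume w: "u @ N # v \<in> configs N k" and w': "u' @ N # v' \<in> configs N k"
      and eq: "u @ fill N (Suc k) b c @ v = u' @ fill N (Suc k) b' c' @ v'"
    have "(u @ (if b then [N] else [])) @ Suc k # ((if c then [N] else []) @ v) =
          (u' @ (if b' then [N] else [])) @ Suc k # ((if c' then [N] else []) @ v')"
      using eq by (simp add: fill_def)
    hence "u @ (if b then [N] else []) = u' @ (if b' then [N] else []) \<and>
           (if c then [N] else []) @ v = (if c' then [N] else []) @ v'"
      using fresh[OF w] fresh[OF w'] assms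
      by (subst (asm) append_Cons_eq_iff) (auto split: if_splits)
    thus "u = u' \<and> v = v' \<and> b = b' \<and> c = c'"
      using append_optional_last_cancel[of u b N u' b'] prepend_optional_hd_cancel[of c N v c' v']
        configsD(1,2)[OF w] configsD(1,2)[OF w'] by blast
  qed
  show "(\<lambda>((u, v), (b, c)). u @ fill N (Suc k) b c @ v) `
          ({(u, v). u @ N # v \<in> configs N k} \<times> UNIV) = configs N (Suc k)"
  proof (intro equalityI subsetI)
    fix w assume "w \<in> (\<lambda>((u, v), (b, c)). u @ fill N (Suc k) b c @ v) `
          ({(u, v). u @ N # v \<in> configs N k} \<times> UNIV)"
    then obtain u v b c where w: "w = u @ fill N (Suc k) b c @ v" and uv: "u @ N # v \<in> configs N k"
      by auto
    have "set w - {N} = insert (Suc k) (set (u @ N # v) - {N})"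
      using assms by (auto simp: w fill_def)
    also have "\<dots> = {1..Suc k}"
      using uv by (simp add: configs_def atLeastAtMostSuc_conv)
    finally have "set w - {N} = {1..Suc k}" .
    moreover have "distinct (filter (\<lambda>x. x \<noteq> N) w)"
      using uv fresh[OF uv] assms by (auto simp: configs_def w fill_def)
    moreover have "successively (\<lambda>x y. \<not> (x = N \<and> y = N)) w"
      using uv assms
      by (cases "v = []"; cases "u = []")
         (simp_all add: configs_def w fill_def successively_append_iff successively_Cons)
    ultimately show "w \<in> configs N (Suc k)"
      by (simp add: configs_def)
  next
    fix w assume w: "w \<in> configs N (Suc k)"
    hence set_w: "set w - {N} = {1..Suc k}" and dist: "distinct (filter (\<lambda>x. x \<noteq> N) w)"
      and succ: "successively (\<lambda>x y. \<not> (x = N \<and> y = N)) w"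
      by (simp_all add: configs_def)
    have "Suc k \<in> set w - {N}" unfolding set_w by simp
    hence "Suc k \<in> set w" by simp
    then obtain x z where xz: "w = x @ Suc k # z" by (auto simp: in_set_conv_decomp)
    (* Undo the insertion: swallow the holes next to the largest letter and put one hole in its place. *)
    define b where "b = (x \<noteq> [] \<and> last x = N)"
    define u where "u = (if b then butlast x else x)"
    define c where "c = (z \<noteq> [] \<and> hd z = N)"
    define v where "v = (if c then tl z else z)"
    have x: "x = u @ (if b then [N] else [])"
      unfolding u_def b_def using append_butlast_last_id[of x] by (auto split: if_splits)
    have z: "z = (if c then [N] else []) @ v"
      unfolding v_def c_def using hd_Cons_tl[of z] by (auto split: if_splits)
    have weq: "w = u @ fill N (Suc k) b c @ v" unfolding xz x z fill_def by simp
    have *: "u \<noteq> [] \<Longrightarrow> last u \<noteq> N"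
    proof (cases b)
      case True
      thus "u \<noteq> [] \<Longrightarrow> last u \<noteq> N" using succ x xz
        by (auto simp: successively_append_iff)
    qed (auto simp: u_def b_def)
    have **: "v \<noteq> [] \<Longrightarrow> hd v \<noteq> N"
    proof (cases c)
      case True
      thus "v \<noteq> [] \<Longrightarrow> hd v \<noteq> N" using succ z xz
        by (auto simp: successively_append_iff successively_Cons)
    qed (auto simp: v_def c_def)
    have nk: "Suc k \<notin> set u \<union> set v" using dist assms
      by (auto simp: weq fill_def)
    have "set (u @ N # v) - {N} = (set w - {N}) - {Suc k}"
      using nk assms by (auto simp: weq fill_def)
    also have "\<dots> = {1..k}" unfolding set_w by auto
    finally have "set (u @ N # v) - {N} = {1..k}" .
    moreover have "distinct (filter (\<lambda>x. x \<noteq> N) (u @ N # v))"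
      using dist assms by (auto simp: weq fill_def)
    moreover have "successively (\<lambda>x y. \<not> (x = N \<and> y = N)) (u @ N # v)"
      using succ * **
      by (auto simp: weq fill_def successively_append_iff successively_Cons)
    ultimately have "u @ N # v \<in> configs N k"
      by (simp add: configs_def)
    thus "w \<in> (\<lambda>((u, v), (b, c)). u @ fill N (Suc k) b c @ v) `
          ({(u, v). u @ N # v \<in> configs N k} \<times> UNIV)"
      unfolding weq by (intro image_eqI[of _ _ "((u, v), (b, c))"]) auto
  qed
qed

lemma holes_Nil [simp]: "holes N [] = {}"
  by (auto simp: holes_def)

lemma holes_Cons:
  "holes N (x # w) = (if x = N then {([], w)} else {}) \<union> map_prod (Cons x) id ` holes N w"
  by (auto simp: holes_def Cons_eq_append_conv image_iff)

lemma finite_holes [simp]: "finite (holes N w)"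
  by (induction w) (auto simp: holes_Cons)

text \<open>
  The \<open>i\<close>-th hole has \<open>i\<close> holes to its left, so it is enough to know how many holes there are.
\<close>

lemma sum_holes:
  fixes g :: "nat \<Rightarrow> nat \<Rightarrow> 'b :: comm_monoid_add"
  shows "(\<Sum>(u, v)\<in>holes N w. g (count_list u N) (count_list v N)) =
         (\<Sum>i<count_list w N. g i (count_list w N - 1 - i))"
proof (induction w arbitrary: g)
  case (Cons x w)
  have "(\<Sum>(u, v)\<in>map_prod (Cons x) id ` holes N w. g (count_list u N) (count_list v N)) =
        (\<Sum>(u, v)\<in>holes N w. g ((if x = N then 1 else 0) + count_list u N) (count_list v N))"
    by (subst sum.reindex) (auto simp: inj_on_def intro!: sum.cong)
  also have "\<dots> = (\<Sum>i<count_list w N. g ((if x = N then 1 else 0) + i) (count_list w N - 1 - i))"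
    by (rule Cons.IH)
  finally have *: "(\<Sum>(u, v)\<in>map_prod (Cons x) id ` holes N w. g (count_list u N) (count_list v N)) = \<dots>" .
  show ?case
  proof (cases "x = N")
    case True
    hence "(\<Sum>(u, v)\<in>holes N (x # w). g (count_list u N) (count_list v N)) =
           g 0 (count_list w N) + (\<Sum>i<count_list w N. g (Suc i) (count_list w N - 1 - i))"
      using * by (simp add: holes_Cons, subst sum.insert) auto
    thus ?thesis using True by (simp add: sum.lessThan_Suc_shift del: sum.lessThan_Suc)
  qed (use * in \<open>simp add: holes_Cons\<close>)
qed simp

lemma configs_0: "configs N 0 = {[], [N]}"
proof -
  have "w \<in> {[], [N]}" if "w \<in> configs N 0" for w
    using that by (cases w; cases "tl w") (auto simp: configs_def successively_Cons)
  thus ?thesis by (auto simp: configs_def)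
qed

lemma finite_configs: "k < N \<Longrightarrow> finite (configs N k)"
proof (induction k)
  case (Suc k)
  have "{(u, v). u @ N # v \<in> configs N k} = (\<Union>w\<in>configs N k. holes N w)"
    by (auto simp: holes_def)
  hence "finite ({(u, v). u @ N # v \<in> configs N k} \<times> (UNIV :: (bool \<times> bool) set))"
    using Suc by simp
  thus ?case using bij_betw_finite[OF bij_betw_fill[OF Suc.prems]] by simp
qed (simp add: configs_0)

text \<open>
  One step of the recursion: a sum over configurations is a sum over their parents and over the
  possible insertions. The next lemma is the form in which it is used, where the contribution of an
  insertion depends on the hole only through the numbers of holes on both sides of it.
\<close>

lemma sum_configs_Suc:
  fixes G :: "nat list \<Rightarrow> 'b :: comm_monoid_add"
  assumes "Suc k < N"
  shows "(\<Sum>w\<in>configs N (Suc k). G w) =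
    (\<Sum>w\<in>configs N k. \<Sum>(u, v)\<in>holes N w. \<Sum>b\<in>UNIV. \<Sum>c\<in>UNIV. G (u @ fill N (Suc k) b c @ v))"
proof -
  let ?S = "{(u, v). u @ N # v \<in> configs N k}"
  have S: "?S = (\<Union>w\<in>configs N k. holes N w)"
    by (auto simp: holes_def)
  have "(\<Sum>w\<in>configs N (Suc k). G w) =
        (\<Sum>((u, v), (b, c))\<in>?S \<times> UNIV. G (u @ fill N (Suc k) b c @ v))"
    using sum.reindex_bij_betw[OF bij_betw_fill[OF assms], of G, symmetric]
    by (simp add: case_prod_unfold)
  also have "\<dots> = (\<Sum>(u, v)\<in>?S. \<Sum>b\<in>UNIV. \<Sum>c\<in>UNIV. G (u @ fill N (Suc k) b c @ v))"
    unfolding UNIV_Times_UNIV[symmetric] sum.cartesian_product' case_prod_unfold by simp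
  also have "\<dots> = (\<Sum>w\<in>configs N k. \<Sum>(u, v)\<in>holes N w. \<Sum>b\<in>UNIV. \<Sum>c\<in>UNIV. G (u @ fill N (Suc k) b c @ v))"
    unfolding S
  proof (rule sum.UNION_disjoint)
    show "finite (configs N k)" using assms finite_configs[of k N] by simp
    show "\<forall>w\<in>configs N k. finite (holes N w)" by simp
    show "\<forall>w\<in>configs N k. \<forall>w'\<in>configs N k. w \<noteq> w' \<longrightarrow> holes N w \<inter> holes N w' = {}"
      by (auto simp: holes_def)
  qed
  finally show ?thesis .
qed

lemma sum_configs_Suc_by_counts:
  fixes G :: "nat list \<Rightarrow> 'b :: comm_monoid_add"
  assumes N: "Suc k < N"
    and g: "\<And>u v. u @ N # v \<in> configs N k \<Longrightarrow>
      (\<Sum>b\<in>UNIV. \<Sum>c\<in>UNIV. G (u @ fill N (Suc k) b c @ v)) =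
      g (u @ N # v) (count_list u N) (count_list v N)"
  shows "(\<Sum>w\<in>configs N (Suc k). G w) =
    (\<Sum>w\<in>configs N k. \<Sum>i<count_list w N. g w i (count_list w N - 1 - i))"
  unfolding sum_configs_Suc[OF N]
proof (rule sum.cong)
  fix w assume w: "w \<in> configs N k"
  have "(\<Sum>(u, v)\<in>holes N w. \<Sum>b\<in>UNIV. \<Sum>c\<in>UNIV. G (u @ fill N (Suc k) b c @ v)) =
        (\<Sum>(u, v)\<in>holes N w. g w (count_list u N) (count_list v N))"
    using w by (intro sum.cong) (auto simp: holes_def g)
  thus "(\<Sum>(u, v)\<in>holes N w. \<Sum>b\<in>UNIV. \<Sum>c\<in>UNIV. G (u @ fill N (Suc k) b c @ v)) =
        (\<Sum>i<count_list w N. g w i (count_list w N - 1 - i))"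
    by (simp only: sum_holes)
qed simp

section \<open>Statistics of a single letter\<close>

fun count_adjacent :: "('b \<Rightarrow> 'b \<Rightarrow> bool) \<Rightarrow> 'b list \<Rightarrow> nat" where
  "count_adjacent P [] = 0"
| "count_adjacent P [x] = 0"
| "count_adjacent P (x # y # zs) = of_bool (P x y) + count_adjacent P (y # zs)"

lemma count_adjacent_Cons: "count_adjacent P (x # ys) = of_bool (ys \<noteq> [] \<and> P x (hd ys)) + count_adjacent P ys"
  by (cases ys) auto

lemma count_adjacent_append:
  "count_adjacent P (xs @ ys) = count_adjacent P xs + count_adjacent P ys + of_bool (xs \<noteq> [] \<and> ys \<noteq> [] \<and> P (last xs) (hd ys))"
  by (induction xs) (auto simp: count_adjacent_Cons)

definition before :: "nat \<Rightarrow> nat list \<Rightarrow> nat list" where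
  "before v w = takeWhile (\<lambda>x. x \<noteq> v) w"

definition after :: "nat \<Rightarrow> nat list \<Rightarrow> nat list" where
  "after v w = tl (dropWhile (\<lambda>x. x \<noteq> v) w)"

lemma before_append [simp]: "v \<notin> set x \<Longrightarrow> before v (x @ v # z) = x"
  by (induction x) (auto simp: before_def)

lemma after_append [simp]: "v \<notin> set x \<Longrightarrow> after v (x @ v # z) = z"
  by (induction x) (auto simp: after_def)

text \<open>
  With \<open>v\<close> as the 2 of the pattern, \<open>falls\<close> counts the patterns 31-2 if applied to the word before \<open>v\<close>,
  and the patterns 2-31 if applied to the word after \<open>v\<close>; \<open>rises\<close>, applied to the word after \<open>v\<close>, counts
  the patterns 2-13.
\<close>

definition falls :: "nat \<Rightarrow> nat list \<Rightarrow> nat" where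
  "falls v xs = count_adjacent (\<lambda>x y. v < x \<and> y < v) xs"

definition rises :: "nat \<Rightarrow> nat list \<Rightarrow> nat" where
  "rises v xs = count_adjacent (\<lambda>x y. x < v \<and> v < y) xs"

definition follows_larger :: "nat \<Rightarrow> nat list \<Rightarrow> bool" where
  "follows_larger v w \<longleftrightarrow> before v w \<noteq> [] \<and> v < last (before v w)"

definition precedes_larger :: "nat \<Rightarrow> nat list \<Rightarrow> bool" where
  "precedes_larger v w \<longleftrightarrow> after v w \<noteq> [] \<and> v < hd (after v w)"

definition lrmax :: "nat \<Rightarrow> nat list \<Rightarrow> bool" where
  "lrmax v w \<longleftrightarrow> (\<forall>x\<in>set (before v w). x < v)"

text \<open>
  For a letter \<open>j\<close> below the inserted letter \<open>K\<close>, the word put in place of a hole looks like a hole: all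
  its letters are larger than \<open>j\<close>.
\<close>

lemma falls_fill: "j < K \<Longrightarrow> K < N \<Longrightarrow> falls j (l @ fill N K b c @ r) = falls j (l @ N # r)"
  by (cases "l = []"; cases "r = []") (auto simp: falls_def fill_def count_adjacent_append count_adjacent_Cons)

lemma rises_fill: "j < K \<Longrightarrow> K < N \<Longrightarrow> rises j (l @ fill N K b c @ r) = rises j (l @ N # r)"
  by (cases "l = []"; cases "r = []") (auto simp: rises_def fill_def count_adjacent_append count_adjacent_Cons)

text \<open>
  An older letter lies on one side of the replaced hole, so only one of the two words around it is
  affected.
\<close>

lemma before_after_fill:
  fixes b c :: bool
  assumes w: "u @ N # v \<in> configs N k" and j: "j \<in> {1..k}" and "Suc k < N"
  shows "before j (u @ fill N (Suc k) b c @ v) = before j (u @ N # v) \<and>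
      (\<exists>l r. after j (u @ N # v) = l @ N # r \<and>
             after j (u @ fill N (Suc k) b c @ v) = l @ fill N (Suc k) b c @ r) \<or>
    after j (u @ fill N (Suc k) b c @ v) = after j (u @ N # v) \<and>
      (\<exists>l r. before j (u @ N # v) = l @ N # r \<and>
             before j (u @ fill N (Suc k) b c @ v) = l @ fill N (Suc k) b c @ r)"
proof (cases "j \<in> set u")
  case True
  then obtain x z where u: "u = x @ j # z" "j \<notin> set x" by (meson split_list_first)
  show ?thesis using u by auto
next
  case False
  moreover have "j \<in> set (u @ N # v) - {N}" using w j by (simp add: configs_def)
  ultimately have "j \<in> set v" by auto
  then obtain x z where v: "v = x @ j # z" "j \<notin> set x" by (meson split_list_first)
  have *: "j \<notin> set (u @ N # x)" "j \<notin> set (u @ fill N (Suc k) b c @ x)"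
    using v False j assms by (auto simp: fill_def)
  have "before j (u @ N # v) = u @ N # x" "after j (u @ N # v) = z"
    "before j (u @ fill N (Suc k) b c @ v) = u @ fill N (Suc k) b c @ x"
    "after j (u @ fill N (Suc k) b c @ v) = z"
    using before_append[OF *(1), of z] after_append[OF *(1), of z]
      before_append[OF *(2), of z] after_append[OF *(2), of z] by (simp_all add: v)
  thus ?thesis by blast
qed

lemma stats_fill:
  fixes b c :: bool
  assumes w: "u @ N # v \<in> configs N k" and j: "j \<in> {1..k}" and N: "Suc k < N"
  defines "w' \<equiv> u @ fill N (Suc k) b c @ v"
  shows "falls j (before j w') = falls j (before j (u @ N # v))"
    and "falls j (after j w') = falls j (after j (u @ N # v))"
    and "rises j (after j w') = rises j (after j (u @ N # v))"
    and "follows_larger j w' = follows_larger j (u @ N # v)"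
    and "precedes_larger j w' = precedes_larger j (u @ N # v)"
    and "lrmax j w' = lrmax j (u @ N # v)"
proof -
  have jk: "j < Suc k" using j by simp
  note * = before_after_fill[OF w j N, of b c, folded w'_def]
  show "falls j (before j w') = falls j (before j (u @ N # v))"
    "falls j (after j w') = falls j (after j (u @ N # v))"
    "rises j (after j w') = rises j (after j (u @ N # v))"
    using * falls_fill[OF jk N] rises_fill[OF jk N] by (elim disjE conjE exE; simp)+
  show "follows_larger j w' = follows_larger j (u @ N # v)"
    using * jk N by (elim disjE conjE exE) (auto simp: follows_larger_def fill_def)
  show "precedes_larger j w' = precedes_larger j (u @ N # v)"
    using * jk N by (elim disjE conjE exE) (auto simp: precedes_larger_def fill_def hd_append)
  show "lrmax j w' = lrmax j (u @ N # v)"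
    using * jk N by (elim disjE conjE exE) (auto simp: lrmax_def fill_def)
qed

text \<open>
  All letters but the holes are smaller than the new letter \<open>k + 1\<close>. So a descent across it starts at a
  hole, and every hole except a final one starts such a descent because holes are not adjacent. The
  mirror image of this holds for ascents.
\<close>

lemma falls_before_new:
  assumes "set u \<subseteq> {1..k} \<union> {N}" "successively (\<lambda>x y. \<not> (x = N \<and> y = N)) u" "Suc k < N"
  shows "falls (Suc k) u + of_bool (u \<noteq> [] \<and> last u = N) = count_list u N"
  using assms
proof (induction u)
  case (Cons x u)
  thus ?case
    by (cases u) (auto simp: falls_def)
qed (simp add: falls_def)

lemma rises_new:
  assumes "set u \<subseteq> {1..k} \<union> {N}" "successively (\<lambda>x y. \<not> (x = N \<and> y = N)) u" "Suc k < N"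
  shows "rises (Suc k) u + of_bool (u \<noteq> [] \<and> hd u = N) = count_list u N"
  using assms
proof (induction u)
  case (Cons x u)
  thus ?case
    by (cases u) (auto simp: rises_def)
qed (simp add: rises_def)

lemma count_list_fill: "v < N \<Longrightarrow> count_list (fill N v b c) N = of_bool b + of_bool c"
  by (auto simp: fill_def)

text \<open>
  The new letter sees only holes. In the count of descents after it, the hole surviving on its
  right (\<open>c\<close>) contributes as any other, whereas the final hole contributes nothing; this is why the
  word is required to end with a hole, and why one pattern 2-31 is lost when the new letter is a descent
  top.
\<close>

lemma stats_new:
  fixes b c :: bool
  assumes w: "u @ N # v \<in> configs N k" and N: "Suc k < N"
  defines "w' \<equiv> u @ fill N (Suc k) b c @ v"
  shows "falls (Suc k) (before (Suc k) w') = count_list u N"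
    and "last (u @ N # v) = N \<Longrightarrow>
         falls (Suc k) (after (Suc k) w') = (if c then count_list v N else count_list v N - 1)"
    and "rises (Suc k) (after (Suc k) w') = count_list v N"
    and "follows_larger (Suc k) w' = b"
    and "precedes_larger (Suc k) w' = c"
    and "lrmax (Suc k) w' \<longleftrightarrow> \<not> b \<and> count_list u N = 0"
proof -
  note D = configsD[OF w]
  have fresh: "Suc k \<notin> set u" "Suc k \<notin> set v"
    using D(3,4) N by auto
  have suc: "successively (\<lambda>x y. \<not> (x = N \<and> y = N)) u" "successively (\<lambda>x y. \<not> (x = N \<and> y = N)) v"
    using w by (auto simp: configs_def successively_append_iff successively_Cons)
  have eq: "w' = (u @ (if b then [N] else [])) @ Suc k # ((if c then [N] else []) @ v)"
    by (simp add: w'_def fill_def)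
  have "Suc k \<notin> set (u @ (if b then [N] else []))"
    using fresh N by auto
  hence before: "before (Suc k) w' = u @ (if b then [N] else [])"
    and after: "after (Suc k) w' = (if c then [N] else []) @ v"
    unfolding eq by (rule before_append, rule after_append)
  show "falls (Suc k) (before (Suc k) w') = count_list u N"
    using falls_before_new[OF D(3) suc(1) N] D(1) N
    by (cases "u = []") (auto simp: before falls_def count_adjacent_append split: if_splits)
  show "falls (Suc k) (after (Suc k) w') = (if c then count_list v N else count_list v N - 1)"
    if "last (u @ N # v) = N"
  proof -
    have "v \<noteq> [] \<Longrightarrow> hd v < Suc k" using D(2,4) by (cases v) auto
    thus ?thesis using falls_before_new[OF D(4) suc(2) N] that N
      by (cases "v = []") (auto simp: after falls_def count_adjacent_Cons)
  qed
  show "rises (Suc k) (after (Suc k) w') = count_list v N"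
    using rises_new[OF D(4) suc(2) N] D(2) N
    by (cases "v = []") (auto simp: after rises_def count_adjacent_Cons split: if_splits)
  show "follows_larger (Suc k) w' = b"
  proof -
    have "u \<noteq> [] \<Longrightarrow> last u < Suc k" using D(1,3) last_in_set[of u] by fastforce
    thus ?thesis using N by (auto simp: follows_larger_def before)
  qed
  show "precedes_larger (Suc k) w' = c"
  proof -
    have "v \<noteq> [] \<Longrightarrow> hd v < Suc k" using D(2,4) hd_in_set[of v] by fastforce
    thus ?thesis using N by (auto simp: precedes_larger_def after)
  qed
  show "lrmax (Suc k) w' \<longleftrightarrow> \<not> b \<and> count_list u N = 0"
  proof -
    have "(\<forall>x\<in>set u. x < Suc k) \<longleftrightarrow> N \<notin> set u" using D(3) N by auto
    thus ?thesis using N by (auto simp: lrmax_def before count_list_0_iff)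
  qed
qed

section \<open>The two weights and their recursion\<close>

context
  fixes a p q y t :: "'a :: comm_ring_1"
begin

definition base_weight :: "nat \<Rightarrow> nat list \<Rightarrow> 'a" where
  "base_weight v w = a ^ of_bool (even v \<and> lrmax v w) * q ^ falls v (before v w) * t ^ of_bool (follows_larger v w)"

text \<open>
  The weights contain the defining conditions of \<open>Y_star_perms\<close> and \<open>X_perms\<close>, letter by letter, as
  factors 0 or 1, so that all sums may run over all configurations. Descents are counted by their
  bottoms in both of them. A letter at the end of the word does not satisfy \<open>precedes_larger\<close>; in \<open>Y_weight\<close>
  this agrees with the convention that a 0 follows the last letter, and forces the last letter to be odd.
\<close>

definition Y_weight :: "nat \<Rightarrow> nat list \<Rightarrow> 'a" where
  "Y_weight v w = of_bool (even v \<longrightarrow> \<not> follows_larger v w \<and> precedes_larger v w) * base_weight v w *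
     p ^ rises v (after v w) * y ^ of_bool (follows_larger v w \<and> \<not> precedes_larger v w)"

definition X_weight :: "nat \<Rightarrow> nat list \<Rightarrow> 'a" where
  "X_weight v w = of_bool (if even v then \<not> follows_larger v w else precedes_larger v w) * base_weight v w *
     p ^ falls v (after v w) * y ^ of_bool (even v \<and> \<not> precedes_larger v w \<and> follows_larger (v - 1) w)"

definition Y_total :: "nat \<Rightarrow> nat list \<Rightarrow> 'a" where
  "Y_total k w = (\<Prod>v=1..k. Y_weight v w)"

text \<open>
  The first factor selects the words ending with a hole, or with the letter \<open>N\<close> itself in the end.
\<close>

definition X_total :: "nat \<Rightarrow> nat \<Rightarrow> nat list \<Rightarrow> 'a" where
  "X_total N k w = of_bool (w \<noteq> [] \<and> last w = N) * (\<Prod>v=1..k. X_weight v w)"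

text \<open>
  The number \<open>[r]\<close> with bases \<open>q\<close> and \<open>p\<close>, and its variant with \<open>a\<close> recording the leftmost choice: only a
  letter placed in the leftmost hole can be a left-to-right maximum.
\<close>

definition pq_int :: "nat \<Rightarrow> 'a" where
  "pq_int r = (\<Sum>i<r. q ^ i * p ^ (r - 1 - i))"

definition pq_int_a :: "nat \<Rightarrow> 'a" where
  "pq_int_a r = (\<Sum>i<r. a ^ of_bool (i = 0) * q ^ i * p ^ (r - 1 - i))"

text \<open>
  The weights of the older letters do not change under an insertion, so the total weight just gets the
  weight of the new letter as a factor.
\<close>

lemma Y_total_fill:
  assumes "u @ N # v \<in> configs N k" "Suc k < N"
  shows "Y_total (Suc k) (u @ fill N (Suc k) b c @ v) =
         Y_total k (u @ N # v) * Y_weight (Suc k) (u @ fill N (Suc k) b c @ v)"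
proof -
  have "(\<Prod>j=1..k. Y_weight j (u @ fill N (Suc k) b c @ v)) = (\<Prod>j=1..k. Y_weight j (u @ N # v))"
    using stats_fill[OF assms(1) _ assms(2), of _ b c]
    by (intro prod.cong) (simp_all add: Y_weight_def base_weight_def)
  thus ?thesis by (simp add: Y_total_def)
qed

lemma X_weights_fill:
  assumes "u @ N # v \<in> configs N k" "Suc k < N"
  shows "(\<Prod>j=1..k. X_weight j (u @ fill N (Suc k) b c @ v)) = (\<Prod>j=1..k. X_weight j (u @ N # v))"
proof (rule prod.cong)
  fix j assume j: "j \<in> {1..k}"
  (* X_weight of an even letter j also looks at j - 1, which is positive and hence an old letter. *)
  have "even j \<Longrightarrow> follows_larger (j - 1) (u @ fill N (Suc k) b c @ v) = follows_larger (j - 1) (u @ N # v)"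
    using j by (intro stats_fill[OF assms(1) _ assms(2)]) (auto elim!: evenE)
  thus "X_weight j (u @ fill N (Suc k) b c @ v) = X_weight j (u @ N # v)"
    using stats_fill[OF assms(1) j assms(2), of b c]
    by (cases "even j") (simp_all add: X_weight_def base_weight_def)
qed simp

text \<open>
  The result ends with a hole iff the hole was put in a word ending with a hole and the last hole did
  not disappear: either the new letter keeps a hole on its right, or it is not in the last hole.
\<close>

lemma X_total_fill:
  assumes "u @ N # v \<in> configs N k" "Suc k < N"
  shows "X_total N (Suc k) (u @ fill N (Suc k) b c @ v) =
         X_total N k (u @ N # v) *
         (of_bool (c \<or> count_list v N > 0) * X_weight (Suc k) (u @ fill N (Suc k) b c @ v))"
proof -
  have "u @ fill N (Suc k) b c @ v \<noteq> [] \<and> last (u @ fill N (Suc k) b c @ v) = N \<longleftrightarrow>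
        last (u @ N # v) = N \<and> (c \<or> count_list v N > 0)"
  proof (cases "v = []")
    case False
    hence "last v = N \<Longrightarrow> N \<in> set v" by auto
    thus ?thesis using False by (auto simp: count_list_0_iff simp flip: neq0_conv)
  qed (use assms in \<open>auto simp: fill_def\<close>)
  thus ?thesis
    using X_weights_fill[OF assms, of b c] by (auto simp: X_total_def)
qed

text \<open>
  The four transfer rules. The unknown \<open>f\<close> is a weight for the number of holes; since it is arbitrary, the
  rules can be iterated. An odd letter of the \<open>Y\<close> family may use all four fillings: a peak, a letter with
  ascents on both sides or descents on both sides, and a valley.
\<close>

lemma sum_Y_total_odd:
  assumes "even k" and N: "Suc k < N"
  shows "(\<Sum>w\<in>configs N (Suc k). Y_total (Suc k) w * f (count_list w N)) =
    (\<Sum>w\<in>configs N k. Y_total k w * (pq_int (count_list w N) *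
       (f (count_list w N - 1) + (1 + y * t) * f (count_list w N) + t * f (count_list w N + 1))))"
    (is "?lhs = (\<Sum>w\<in>_. Y_total k w * (_ * ?F w))")
proof -
  let ?g = "\<lambda>w i c. Y_total k w * (q ^ i * p ^ c *
    (f (i + c) + (1 + y * t) * f (i + c + 1) + t * f (i + c + 2)))"
  have "?lhs = (\<Sum>w\<in>configs N k. \<Sum>i<count_list w N. ?g w i (count_list w N - 1 - i))"
  proof (rule sum_configs_Suc_by_counts[OF N])
    fix u v assume uv: "u @ N # v \<in> configs N k"
    show "(\<Sum>b\<in>UNIV. \<Sum>c\<in>UNIV. Y_total (Suc k) (u @ fill N (Suc k) b c @ v) *
             f (count_list (u @ fill N (Suc k) b c @ v) N)) =
          ?g (u @ N # v) (count_list u N) (count_list v N)"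
      unfolding Y_total_fill[OF uv N] UNIV_bool Y_weight_def base_weight_def
      using \<open>even k\<close>
      by (simp add: stats_new[OF uv N] count_list_fill[OF N] algebra_simps del: append_assoc)
  qed
  also have "\<dots> = (\<Sum>w\<in>configs N k. Y_total k w * (pq_int (count_list w N) * ?F w))"
    unfolding pq_int_def sum_distrib_left sum_distrib_right by (intro sum.cong) auto
  finally show ?thesis .
qed

text \<open>
  Here only the filling with a hole on the right and none on the left is allowed.
\<close>

lemma sum_Y_total_even:
  assumes "odd k" and N: "Suc k < N"
  shows "(\<Sum>w\<in>configs N (Suc k). Y_total (Suc k) w * f (count_list w N)) =
    (\<Sum>w\<in>configs N k. Y_total k w * (pq_int_a (count_list w N) * f (count_list w N)))"
    (is "?lhs = ?rhs")
proof -
  let ?g = "\<lambda>w i c. Y_total k w * (a ^ of_bool (i = 0) * q ^ i * p ^ c * f (i + c + 1))"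
  have "?lhs = (\<Sum>w\<in>configs N k. \<Sum>i<count_list w N. ?g w i (count_list w N - 1 - i))"
  proof (rule sum_configs_Suc_by_counts[OF N])
    fix u v assume uv: "u @ N # v \<in> configs N k"
    show "(\<Sum>b\<in>UNIV. \<Sum>c\<in>UNIV. Y_total (Suc k) (u @ fill N (Suc k) b c @ v) *
             f (count_list (u @ fill N (Suc k) b c @ v) N)) =
          ?g (u @ N # v) (count_list u N) (count_list v N)"
      unfolding Y_total_fill[OF uv N] UNIV_bool Y_weight_def base_weight_def
      using \<open>odd k\<close>
      by (simp add: stats_new[OF uv N] count_list_fill[OF N] algebra_simps del: append_assoc)
  qed
  also have "\<dots> = ?rhs"
    unfolding pq_int_a_def sum_distrib_left sum_distrib_right by (intro sum.cong) auto
  finally show ?thesis .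
qed

text \<open>
  The weight \<open>f\<close> may also depend on whether the new odd letter is a descent bottom: the next, even letter
  needs this for the exponent of \<open>y\<close>.
\<close>

lemma sum_X_total_odd:
  assumes "even k" and N: "Suc k < N"
  shows "(\<Sum>w\<in>configs N (Suc k). X_total N (Suc k) w * f (follows_larger (Suc k) w) (count_list w N)) =
    (\<Sum>w\<in>configs N k. X_total N k w * (pq_int (count_list w N) *
       (f False (count_list w N) + t * f True (count_list w N + 1))))"
    (is "?lhs = (\<Sum>w\<in>_. X_total N k w * (_ * ?F w))")
proof -
  let ?g = "\<lambda>w i c. X_total N k w *
    (q ^ i * p ^ c * (f False (i + c + 1) + t * f True (i + c + 2)))"
  have "?lhs = (\<Sum>w\<in>configs N k. \<Sum>i<count_list w N. ?g w i (count_list w N - 1 - i))"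
  proof (rule sum_configs_Suc_by_counts[OF N])
    fix u v assume uv: "u @ N # v \<in> configs N k"
    show "(\<Sum>b\<in>UNIV. \<Sum>c\<in>UNIV. X_total N (Suc k) (u @ fill N (Suc k) b c @ v) *
             f (follows_larger (Suc k) (u @ fill N (Suc k) b c @ v))
               (count_list (u @ fill N (Suc k) b c @ v) N)) =
          ?g (u @ N # v) (count_list u N) (count_list v N)"
    proof (cases "last (u @ N # v) = N")
      case True
      show ?thesis
        unfolding X_total_fill[OF uv N] UNIV_bool X_weight_def base_weight_def
        using \<open>even k\<close>
        by (simp add: stats_new[OF uv N] stats_new(2)[OF uv N True] count_list_fill[OF N] algebra_simps
              del: append_assoc)
    next
      case False
      hence "X_total N k (u @ N # v) = 0" by (simp add: X_total_def)
      thus ?thesis by (simp add: X_total_fill[OF uv N])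
    qed
  qed
  also have "\<dots> = (\<Sum>w\<in>configs N k. X_total N k w * (pq_int (count_list w N) * ?F w))"
    unfolding pq_int_def sum_distrib_left sum_distrib_right by (intro sum.cong) auto
  finally show ?thesis .
qed

text \<open>
  A descent top cannot be placed in the last hole and takes part in one pattern 2-31 less than the
  number of holes to its right; together these turn \<open>r\<close> into \<open>r - 1\<close>.
\<close>

lemma pq_int_a_pred:
  "(\<Sum>i<r. of_bool (0 < r - 1 - i) * (a ^ of_bool (i = 0) * q ^ i * p ^ (r - 1 - i - 1))) = pq_int_a (r - 1)"
proof (cases r)
  case (Suc s)
  have "(\<Sum>i<s. of_bool (0 < s - i) * (a ^ of_bool (i = 0) * q ^ i * p ^ (s - i - 1))) = pq_int_a s"
    unfolding pq_int_a_def by (intro sum.cong) auto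
  thus ?thesis using Suc by simp
qed (simp add: pq_int_a_def)

lemma sum_X_total_even:
  assumes "odd k" and N: "Suc k < N"
  shows "(\<Sum>w\<in>configs N (Suc k). X_total N (Suc k) w * f (count_list w N)) =
    (\<Sum>w\<in>configs N k. X_total N k w * (pq_int_a (count_list w N) * f (count_list w N) +
       y ^ of_bool (follows_larger k w) * pq_int_a (count_list w N - 1) * f (count_list w N - 1)))"
    (is "?lhs = ?rhs")
proof -
  let ?g = "\<lambda>w i c. X_total N k w * (a ^ of_bool (i = 0) * q ^ i * p ^ c * f (i + c + 1) +
    y ^ of_bool (follows_larger k w) *
      (of_bool (0 < c) * (a ^ of_bool (i = 0) * q ^ i * p ^ (c - 1))) * f (i + c))"
  have k: "k \<in> {1..k}" using \<open>odd k\<close> by (auto elim: oddE)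
  have "?lhs = (\<Sum>w\<in>configs N k. \<Sum>i<count_list w N. ?g w i (count_list w N - 1 - i))"
  proof (rule sum_configs_Suc_by_counts[OF N])
    fix u v assume uv: "u @ N # v \<in> configs N k"
    show "(\<Sum>b\<in>UNIV. \<Sum>c\<in>UNIV. X_total N (Suc k) (u @ fill N (Suc k) b c @ v) *
             f (count_list (u @ fill N (Suc k) b c @ v) N)) =
          ?g (u @ N # v) (count_list u N) (count_list v N)"
    proof (cases "last (u @ N # v) = N")
      case True
      show ?thesis
        unfolding X_total_fill[OF uv N] UNIV_bool X_weight_def base_weight_def
        using \<open>odd k\<close>
        by (simp add: stats_new[OF uv N] stats_new(2)[OF uv N True] stats_fill(4)[OF uv k N]
              count_list_fill[OF N] algebra_simps del: append_assoc)
    next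
      case False
      hence "X_total N k (u @ N # v) = 0" by (simp add: X_total_def)
      thus ?thesis by (simp add: X_total_fill[OF uv N])
    qed
  qed
  also have "\<dots> = (\<Sum>w\<in>configs N k. \<Sum>i<count_list w N. X_total N k w *
      (a ^ of_bool (i = 0) * q ^ i * p ^ (count_list w N - 1 - i) * f (count_list w N) +
       y ^ of_bool (follows_larger k w) * (of_bool (0 < count_list w N - 1 - i) *
         (a ^ of_bool (i = 0) * q ^ i * p ^ (count_list w N - 1 - i - 1))) * f (count_list w N - 1)))"
    by (intro sum.cong) auto
  also have "\<dots> = ?rhs"
    unfolding pq_int_a_pred[symmetric] unfolding pq_int_a_def
    by (simp only: sum.distrib distrib_left sum_distrib_left sum_distrib_right)
  finally show ?thesis .
qed

text \<open>
  Composing an odd and an even step gives the same operator on \<open>f\<close> in both families. The condition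
  \<open>f 0 = 0\<close> discards the empty word, which is a configuration at stage 0 but does not end with a hole.
\<close>

theorem sum_X_total_eq_sum_Y_total:
  assumes "2 * j < N" "f 0 = 0"
  shows "(\<Sum>w\<in>configs N (2 * j). X_total N (2 * j) w * f (count_list w N)) =
         (\<Sum>w\<in>configs N (2 * j). Y_total (2 * j) w * f (count_list w N))"
  using assms
proof (induction j arbitrary: f)
  case 0
  thus ?case by (simp add: configs_0 X_total_def Y_total_def)
next
  case (Suc j)
  let ?k = "2 * j"
  (* The common transfer operator, applied to f. *)
  let ?T = "\<lambda>r. pq_int r * (pq_int_a (r - 1) * f (r - 1) + (1 + y * t) * (pq_int_a r * f r) +
                 t * (pq_int_a (r + 1) * f (r + 1)))"
  have N: "Suc ?k < N" "Suc (Suc ?k) < N" and k: "even ?k" "odd (Suc ?k)"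
    using Suc.prems by auto
  have X: "(\<Sum>w\<in>configs N (Suc (Suc ?k)). X_total N (Suc (Suc ?k)) w * f (count_list w N)) =
           (\<Sum>w\<in>configs N ?k. X_total N ?k w * ?T (count_list w N))"
    unfolding sum_X_total_even[OF k(2) N(2)]
    by (subst sum_X_total_odd[OF k(1) N(1), of "\<lambda>b r. pq_int_a r * f r + y ^ of_bool b * pq_int_a (r - 1) * f (r - 1)"])
       (intro sum.cong; simp add: algebra_simps)
  have Y: "(\<Sum>w\<in>configs N (Suc (Suc ?k)). Y_total (Suc (Suc ?k)) w * f (count_list w N)) =
           (\<Sum>w\<in>configs N ?k. Y_total ?k w * ?T (count_list w N))"
    unfolding sum_Y_total_even[OF k(2) N(2)]
    by (subst sum_Y_total_odd[OF k(1) N(1), of "\<lambda>r. pq_int_a r * f r"]) (rule refl)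
  have "?T 0 = 0" by (simp add: pq_int_def)
  thus ?case using X Y Suc.IH[of ?T] Suc.prems by simp
qed

end

section \<open>Permutations as words\<close>

definition word :: "nat \<Rightarrow> (nat \<Rightarrow> nat) \<Rightarrow> nat list" where
  "word N s = map s [1..<Suc N]"

lemma successively_notin: "N \<notin> set w \<Longrightarrow> successively (\<lambda>x y. x = N \<longrightarrow> y \<noteq> N) w"
  by (induction w) (auto simp: successively_Cons)

text \<open>
  With all letters below \<open>N\<close> inserted and one hole left, the hole is the letter \<open>N\<close>.
\<close>

lemma configs_one_hole_iff:
  assumes "N \<ge> 1"
  shows "w \<in> configs N (N - 1) \<and> count_list w N = 1 \<longleftrightarrow> distinct w \<and> set w = {1..N}"
proof
  assume w: "distinct w \<and> set w = {1..N}"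
  hence "N \<in> set w" using assms by simp
  then obtain x z where xz: "w = x @ N # z" by (auto simp: in_set_conv_decomp)
  have "count_list w N = 1" using w by (simp add: xz count_list_0_iff)
  moreover have "successively (\<lambda>x y. \<not> (x = N \<and> y = N)) w"
  proof -
    have "N \<notin> set x" "N \<notin> set z" using w by (simp_all add: xz)
    moreover from this have "x \<noteq> [] \<Longrightarrow> last x \<noteq> N" "z \<noteq> [] \<Longrightarrow> hd z \<noteq> N"
      using last_in_set[of x] hd_in_set[of z] by metis+
    ultimately show ?thesis
      by (auto simp: xz successively_append_iff successively_Cons successively_notin)
  qed
  moreover have "set w - {N} = {1..N - 1}" unfolding conjunct2[OF w] using assms by auto
  ultimately show "w \<in> configs N (N - 1) \<and> count_list w N = 1"
    using w by (simp add: configs_def)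
next
  assume w: "w \<in> configs N (N - 1) \<and> count_list w N = 1"
  hence "count_list w N \<noteq> 0" by simp
  hence "N \<in> set w" by (simp add: count_list_0_iff)
  hence "set w = insert N (set w - {N})" by (simp add: insert_absorb)
  also have "set w - {N} = {1..N - 1}" using w by (simp add: configs_def)
  also have "insert N {1..N - 1} = {1..N}" using assms by auto
  finally have set: "set w = {1..N}" .
  from \<open>N \<in> set w\<close> obtain x z where xz: "w = x @ N # z" by (auto simp: in_set_conv_decomp)
  have "N \<notin> set x" "N \<notin> set z" using w by (auto simp: xz count_list_0_iff)
  hence "filter (\<lambda>x. x \<noteq> N) x = x" "filter (\<lambda>x. x \<noteq> N) z = z"
    by (auto simp: filter_id_conv)
  hence "distinct w" using w \<open>N \<notin> set x\<close> \<open>N \<notin> set z\<close> by (simp add: configs_def xz)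
  thus "distinct w \<and> set w = {1..N}" using set by simp
qed

lemma bij_betw_word:
  "bij_betw (word N) {s. s permutes {1..N}} {w. distinct w \<and> set w = {1..N}}"
  unfolding bij_betw_def
proof
  show "inj_on (word N) {s. s permutes {1..N}}"
  proof (rule inj_onI, rule ext)
    fix s s' i
    assume s: "s \<in> {s. s permutes {1..N}}" "s' \<in> {s. s permutes {1..N}}" and eq: "word N s = word N s'"
    show "s i = s' i"
    proof (cases "i \<in> {1..N}")
      case True
      hence "i \<in> set [1..<Suc N]" by auto
      thus ?thesis using eq unfolding word_def map_eq_conv by blast
    qed (use s in \<open>auto dest!: permutes_not_in\<close>)
  qed
  show "word N ` {s. s permutes {1..N}} = {w. distinct w \<and> set w = {1..N}}"
  proof (intro equalityI subsetI)
    fix w assume "w \<in> word N ` {s. s permutes {1..N}}"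
    then obtain s where s: "w = word N s" "s permutes {1..N}" by auto
    have "set [1..<Suc N] = {1..N}" by auto
    thus "w \<in> {w. distinct w \<and> set w = {1..N}}"
      using permutes_image[OF s(2)] permutes_inj_on[OF s(2)]
      by (simp add: s(1) word_def distinct_map del: upt_Suc)
  next
    fix w assume "w \<in> {w. distinct w \<and> set w = {1..N}}"
    hence w: "distinct w" "set w = {1..N}" by auto
    have len: "length w = N" using distinct_card[OF w(1)] w(2) by simp
    define s where "s i = (if i \<in> {1..N} then w ! (i - 1) else i)" for i
    have "bij_betw (\<lambda>i. i - 1) {1..N} {..<N}"
      by (rule bij_betw_byWitness[where f' = Suc]) auto
    moreover have "bij_betw ((!) w) {..<N} {1..N}"
      using bij_betw_nth[OF w(1)] w(2) len by simp
    ultimately have "bij_betw ((!) w \<circ> (\<lambda>i. i - 1)) {1..N} {1..N}"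
      by (rule bij_betw_trans)
    hence "bij_betw s {1..N} {1..N}"
      by (rule bij_betw_cong[THEN iffD1, rotated]) (simp add: s_def)
    hence "s permutes {1..N}" by (rule bij_imp_permutes) (auto simp: s_def)
    moreover have "word N s = w"
      by (rule nth_equalityI) (auto simp: word_def s_def len nth_append simp del: upt_Suc)
    ultimately show "w \<in> word N ` {s. s permutes {1..N}}" by auto
  qed
qed

lemma count_adjacent_map_upt:
  "count_adjacent P (map s [i..<j]) = card {l. i \<le> l \<and> Suc l < j \<and> P (s l) (s (Suc l))}"
proof (induction j)
  case (Suc j)
  show ?case
  proof (cases "i < j")
    case True
    then obtain j' where j: "j = Suc j'" "i \<le> j'" by (cases j) auto
    have "{l. i \<le> l \<and> Suc l < Suc j \<and> P (s l) (s (Suc l))} =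
          {l. i \<le> l \<and> Suc l < j \<and> P (s l) (s (Suc l))} \<union> (if P (s j') (s j) then {j'} else {})"
      using j by (auto simp: less_Suc_eq)
    thus ?thesis using Suc j by (auto simp: count_adjacent_append)
  next
    case False
    thus ?thesis by (cases "i = j") auto
  qed
qed simp

lemma before_after_word:
  assumes s: "s permutes {1..N}" and i: "i \<in> {1..N}"
  shows "before (s i) (word N s) = map s [1..<i]" "after (s i) (word N s) = map s [Suc i..<Suc N]"
proof -
  have "i + (Suc N - i) = Suc N" using i by simp
  hence "[1..<Suc N] = [1..<i] @ [i..<Suc N]"
    using i upt_add_eq_append[of 1 i "Suc N - i"] by simp
  also have "[i..<Suc N] = i # [Suc i..<Suc N]"
    using i by (intro upt_conv_Cons) simp
  finally have "[1..<Suc N] = [1..<i] @ i # [Suc i..<Suc N]" .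
  hence "word N s = map s [1..<i] @ s i # map s [Suc i..<Suc N]"
    by (simp add: word_def del: upt_Suc)
  moreover have fresh: "s i \<notin> set (map s [1..<i])"
    using permutes_inj[OF s] by (simp add: inj_image_mem_iff)
  ultimately show "before (s i) (word N s) = map s [1..<i]" "after (s i) (word N s) = map s [Suc i..<Suc N]"
    by (simp_all only: before_append[OF fresh] after_append[OF fresh])
qed

lemma follows_larger_word:
  assumes "s permutes {1..N}" "i \<in> {1..N}"
  shows "follows_larger (s i) (word N s) \<longleftrightarrow> 1 < i \<and> s i < s (i - 1)"
  unfolding follows_larger_def before_after_word[OF assms] by (auto simp: last_map last_upt)

lemma precedes_larger_word:
  assumes "s permutes {1..N}" "i \<in> {1..N}"
  shows "precedes_larger (s i) (word N s) \<longleftrightarrow> i < N \<and> s i < s (Suc i)"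
  unfolding precedes_larger_def before_after_word[OF assms] by (auto simp: hd_map hd_upt simp del: upt_Suc)

lemma lrmax_word:
  assumes "s permutes {1..N}" "i \<in> {1..N}"
  shows "lrmax (s i) (word N s) \<longleftrightarrow> (\<forall>j. 1 \<le> j \<and> j < i \<longrightarrow> s j < s i)"
  unfolding lrmax_def before_after_word[OF assms] by auto

text \<open>
  Statistics that are defined by positions are counted by values, because the weights are indexed by
  letters.
\<close>

lemma card_values:
  assumes "s permutes {1..N}"
  shows "card {v \<in> {1..N}. P v} = card {i \<in> {1..N}. P (s i)}"
proof -
  have "{v \<in> {1..N}. P v} = s ` {i \<in> {1..N}. P (s i)}"
    by (subst permutes_image[OF assms, symmetric]) auto
  thus ?thesis by (simp add: card_image permutes_inj_on[OF assms])
qed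

lemma pat_31_2_word:
  assumes s: "s permutes {1..N}"
  shows "pat_31_2 N s = (\<Sum>v=1..N. falls v (before v (word N s)))"
proof -
  have "pat_31_2 N s = card (SIGMA j:{1..N}. {l. 1 \<le> l \<and> Suc l < j \<and> s j < s l \<and> s (Suc l) < s j})"
    unfolding pat_31_2_def
    by (rule bij_betw_same_card, rule bij_betw_byWitness[where f = "\<lambda>(i, j). (j, i - 1)" and f' = "\<lambda>(j, l). (Suc l, j)"])
       auto
  also have "\<dots> = (\<Sum>j=1..N. card {l. 1 \<le> l \<and> Suc l < j \<and> s j < s l \<and> s (Suc l) < s j})"
    by (subst card_SigmaI) (auto intro: finite_subset[of _ "{..N}"])
  also have "\<dots> = (\<Sum>j=1..N. falls (s j) (before (s j) (word N s)))"
    by (intro sum.cong) (simp_all add: before_after_word[OF s] falls_def count_adjacent_map_upt)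
  also have "\<dots> = (\<Sum>v=1..N. falls v (before v (word N s)))"
    using sum.permute[OF s, of "\<lambda>v. falls v (before v (word N s))"] by (simp add: comp_def)
  finally show ?thesis .
qed

lemma pat_2_31_word:
  assumes s: "s permutes {1..N}"
  shows "pat_2_31 N s = (\<Sum>v=1..N. falls v (after v (word N s)))"
proof -
  have "{(i, j). 1 \<le> i \<and> i < j \<and> j + 1 \<le> N \<and> s j > s i \<and> s i > s (j + 1)} =
        (SIGMA i:{1..N}. {j. Suc i \<le> j \<and> Suc j < Suc N \<and> s i < s j \<and> s (Suc j) < s i})"
    by auto
  hence "pat_2_31 N s = card (SIGMA i:{1..N}. {j. Suc i \<le> j \<and> Suc j < Suc N \<and> s i < s j \<and> s (Suc j) < s i})"
    unfolding pat_2_31_def by simp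
  also have "\<dots> = (\<Sum>i=1..N. card {j. Suc i \<le> j \<and> Suc j < Suc N \<and> s i < s j \<and> s (Suc j) < s i})"
    by (subst card_SigmaI) (auto intro: finite_subset[of _ "{..N}"])
  also have "\<dots> = (\<Sum>i=1..N. falls (s i) (after (s i) (word N s)))"
    by (intro sum.cong) (simp_all add: before_after_word[OF s] falls_def count_adjacent_map_upt del: upt_Suc)
  also have "\<dots> = (\<Sum>v=1..N. falls v (after v (word N s)))"
    using sum.permute[OF s, of "\<lambda>v. falls v (after v (word N s))"] by (simp add: comp_def)
  finally show ?thesis .
qed

lemma pat_2_13_word:
  assumes s: "s permutes {1..N}"
  shows "pat_2_13 N s = (\<Sum>v=1..N. rises v (after v (word N s)))"
proof -
  have "{(i, j). 1 \<le> i \<and> i < j \<and> j + 1 \<le> N \<and> s (j + 1) > s i \<and> s i > s j} =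
        (SIGMA i:{1..N}. {j. Suc i \<le> j \<and> Suc j < Suc N \<and> s j < s i \<and> s i < s (Suc j)})"
    by auto
  hence "pat_2_13 N s = card (SIGMA i:{1..N}. {j. Suc i \<le> j \<and> Suc j < Suc N \<and> s j < s i \<and> s i < s (Suc j)})"
    unfolding pat_2_13_def by simp
  also have "\<dots> = (\<Sum>i=1..N. card {j. Suc i \<le> j \<and> Suc j < Suc N \<and> s j < s i \<and> s i < s (Suc j)})"
    by (subst card_SigmaI) (auto intro: finite_subset[of _ "{..N}"])
  also have "\<dots> = (\<Sum>i=1..N. rises (s i) (after (s i) (word N s)))"
    by (intro sum.cong) (simp_all add: before_after_word[OF s] rises_def count_adjacent_map_upt del: upt_Suc)
  also have "\<dots> = (\<Sum>v=1..N. rises v (after v (word N s)))"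
    using sum.permute[OF s, of "\<lambda>v. rises v (after v (word N s))"] by (simp add: comp_def)
  finally show ?thesis .
qed

lemma lema_word:
  assumes s: "s permutes {1..N}"
  shows "lema N s = card {v \<in> {1..N}. even v \<and> lrmax v (word N s)}"
proof -
  have "{s i | i. 1 \<le> i \<and> i \<le> N \<and> even (s i) \<and> (\<forall>j. 1 \<le> j \<and> j < i \<longrightarrow> s j < s i)} =
        s ` {i \<in> {1..N}. even (s i) \<and> lrmax (s i) (word N s)}"
    using lrmax_word[OF s] by auto
  thus ?thesis
    unfolding lema_def by (subst card_values[OF s]) (simp add: card_image permutes_inj_on[OF s])
qed

text \<open>
  A descent is determined by its bottom.
\<close>

lemma des_word:
  assumes s: "s permutes {1..N}"
  shows "des N s = card {v \<in> {1..N}. follows_larger v (word N s)}"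
proof -
  have "{i \<in> {1..N}. follows_larger (s i) (word N s)} = {i \<in> {1..N}. 1 < i \<and> s i < s (i - 1)}"
    by (rule Collect_cong, rule conj_cong[OF refl], erule follows_larger_word[OF s])
  also have "card \<dots> = card {i. 1 \<le> i \<and> i < N \<and> s (Suc i) < s i}"
    by (rule bij_betw_same_card, rule bij_betw_byWitness[where f = "\<lambda>i. i - 1" and f' = Suc]) auto
  finally have "card {i \<in> {1..N}. follows_larger (s i) (word N s)} = card {i. 1 \<le> i \<and> i < N \<and> s (Suc i) < s i}" .
  moreover have "descents N s = (\<lambda>i. (s i, s (Suc i))) ` {i. 1 \<le> i \<and> i < N \<and> s (Suc i) < s i}"
    by (auto simp: descents_def)
  moreover have "inj_on (\<lambda>i. (s i, s (Suc i))) A" for A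
    using permutes_inj[OF s] by (simp add: inj_on_def)
  ultimately show ?thesis
    unfolding des_def by (subst card_values[OF s]) (simp add: card_image)
qed

lemma dd_word:
  assumes s: "s permutes {1..N}"
  shows "dd N s = card {v \<in> {1..N}. follows_larger v (word N s) \<and> \<not> precedes_larger v (word N s)}"
proof -
  have "pad N s (i - 1) > pad N s i \<and> pad N s i > pad N s (i + 1) \<longleftrightarrow>
        follows_larger (s i) (word N s) \<and> \<not> precedes_larger (s i) (word N s)" if i: "i \<in> {1..N}" for i
  proof -
    have "s i \<in> {1..N}" using i permutes_in_image[OF s, of i] by simp
    moreover have "s (Suc i) \<noteq> s i" using permutes_inj[OF s] by (simp add: inj_eq)
    ultimately show ?thesis
      using i unfolding follows_larger_word[OF s i] precedes_larger_word[OF s i]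
      by (cases "i = N"; cases "i = 1") (auto simp: pad_def)
  qed
  hence "{i. 1 \<le> i \<and> i \<le> N \<and> pad N s (i - 1) > pad N s i \<and> pad N s i > pad N s (i + 1)} =
         {i \<in> {1..N}. follows_larger (s i) (word N s) \<and> \<not> precedes_larger (s i) (word N s)}"
    by auto
  thus ?thesis unfolding dd_def by (subst card_values[OF s]) simp
qed

section \<open>The weights are the statistics\<close>

text \<open>
  The weights are products over the letters \<open>1, \<dots>, 2 * n\<close>, whereas the statistics see the letter
  \<open>2 * n + 1\<close> as well. As the largest letter, and an odd one, it contributes nothing.
\<close>

lemma falls_max_letter: "set xs \<subseteq> {..N} \<Longrightarrow> falls N xs = 0"
  by (induction xs) (auto simp: falls_def count_adjacent_Cons)

lemma rises_max_letter: "set xs \<subseteq> {..N} \<Longrightarrow> rises N xs = 0"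
proof (induction xs)
  case (Cons x xs)
  thus ?case by (cases xs) (auto simp: rises_def)
qed (simp add: rises_def)

lemma set_before_subset: "set (before v w) \<subseteq> set w"
  by (auto simp: before_def dest: set_takeWhileD)

lemma set_after_subset: "set (after v w) \<subseteq> set w"
proof -
  have "set (after v w) \<subseteq> set (dropWhile (\<lambda>x. x \<noteq> v) w)"
    unfolding after_def by (metis list.set_sel(2) subsetI tl_Nil)
  thus ?thesis using set_dropWhileD[of _ "\<lambda>x. x \<noteq> v" w] by blast
qed

lemma max_letter:
  assumes "set w \<subseteq> {..N}"
  shows "falls N (before N w) = 0" "falls N (after N w) = 0" "rises N (after N w) = 0" "\<not> follows_larger N w"
proof -
  have *: "set (before N w) \<subseteq> {..N}" "set (after N w) \<subseteq> {..N}"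
    using assms set_before_subset[of N w] set_after_subset[of N w] by blast+
  show "falls N (before N w) = 0" "falls N (after N w) = 0" "rises N (after N w) = 0"
    by (intro falls_max_letter rises_max_letter *)+
  show "\<not> follows_larger N w"
  proof
    assume "follows_larger N w"
    hence "before N w \<noteq> []" "N < last (before N w)" by (auto simp: follows_larger_def)
    thus False using *(1) last_in_set[of "before N w"] by fastforce
  qed
qed

lemma card_drop_max: "\<not> P (m + 1) \<Longrightarrow> card {v \<in> {1..m + 1}. P v} = card {v \<in> {1..m}. P v}"
  for m :: nat
  by (rule arg_cong[of _ _ card]) (auto simp: le_Suc_eq)

lemma sum_drop_max: "f (m + 1) = 0 \<Longrightarrow> (\<Sum>v=1..m + 1. f v) = (\<Sum>v=1..m. f v)"
  for m :: nat
  by simp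

lemma prod_of_bool: "finite A \<Longrightarrow> (\<Prod>v\<in>A. of_bool (P v)) = (of_bool (\<forall>v\<in>A. P v) :: 'a :: comm_semiring_1)"
  by (induction A rule: finite_induct) auto

lemma prod_power_of_bool: "finite A \<Longrightarrow> (\<Prod>v\<in>A. x ^ of_bool (P v)) = (x :: 'a :: comm_semiring_1) ^ card {v \<in> A. P v}"
  unfolding power_sum[symmetric] sum_of_bool_eq Int_def by simp

lemma set_word: "s permutes {1..N} \<Longrightarrow> set (word N s) = {1..N}"
  using bij_betw_word[of N] by (auto simp: bij_betw_def)

lemma ball_values:
  assumes "s permutes {1..N}"
  shows "(\<forall>v\<in>{1..N}. P v) \<longleftrightarrow> (\<forall>i\<in>{1..N}. P (s i))"
  by (subst permutes_image[OF assms, symmetric]) blast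

lemma descents_iff: "(x, z) \<in> descents m s \<longleftrightarrow> (\<exists>i. 1 \<le> i \<and> i < m \<and> s (Suc i) < s i \<and> x = s i \<and> z = s (Suc i))"
  by (auto simp: descents_def)

text \<open>
  Membership is a condition on each letter: an even letter may be neither bottom nor top of a
  descent, and it may not be the last letter, which \<open>precedes_larger\<close> excludes too.
\<close>

lemma Y_star_perms_iff:
  assumes s: "s permutes {1..2 * n + 1}"
  defines "w \<equiv> word (2 * n + 1) s"
  shows "s \<in> Y_star_perms n \<longleftrightarrow> (\<forall>v\<in>{1..2 * n}. even v \<longrightarrow> \<not> follows_larger v w \<and> precedes_larger v w)"
proof -
  let ?N = "2 * n + 1"
  have neq: "s (Suc i) \<noteq> s i" for i using permutes_inj[OF s] by (simp add: inj_eq)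
  have "(\<forall>v\<in>{1..2 * n}. even v \<longrightarrow> \<not> follows_larger v w \<and> precedes_larger v w) \<longleftrightarrow>
        (\<forall>v\<in>insert ?N {1..2 * n}. even v \<longrightarrow> \<not> follows_larger v w \<and> precedes_larger v w)"
    by simp
  also have "insert ?N {1..2 * n} = {1..?N}" by auto
  also have "(\<forall>v\<in>{1..?N}. even v \<longrightarrow> \<not> follows_larger v w \<and> precedes_larger v w) \<longleftrightarrow>
             (\<forall>i\<in>{1..?N}. even (s i) \<longrightarrow> \<not> follows_larger (s i) w \<and> precedes_larger (s i) w)"
    by (rule ball_values[OF s])
  also have "\<dots> \<longleftrightarrow> (\<forall>i\<in>{1..?N}. even (s i) \<longrightarrow> \<not> (1 < i \<and> s i < s (i - 1)) \<and> i < ?N \<and> s i < s (Suc i))"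
    unfolding w_def by (rule ball_cong[OF refl]) (simp only: follows_larger_word[OF s] precedes_larger_word[OF s])
  also have "\<dots> \<longleftrightarrow> (\<forall>(x, z)\<in>descents ?N s. odd x \<and> odd z) \<and> odd (s ?N)"
  proof (intro iffI conjI ballI impI)
    assume *: "\<forall>i\<in>{1..?N}. even (s i) \<longrightarrow> \<not> (1 < i \<and> s i < s (i - 1)) \<and> i < ?N \<and> s i < s (Suc i)"
    show "odd (s ?N)" using *[rule_format, of ?N] by auto
    show "case xz of (x, z) \<Rightarrow> odd x \<and> odd z" if "xz \<in> descents ?N s" for xz
    proof -
      from that obtain i where i: "1 \<le> i" "i < ?N" "s (Suc i) < s i" "xz = (s i, s (Suc i))"
        by (cases xz) (auto simp: descents_iff)
      thus ?thesis using *[rule_format, of i] *[rule_format, of "Suc i"] by auto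
    qed
  next
    fix i assume *: "(\<forall>(x, z)\<in>descents ?N s. odd x \<and> odd z) \<and> odd (s ?N)"
      and i: "i \<in> {1..?N}" and ev: "even (s i)"
    have D: "odd (s j) \<and> odd (s (Suc j))" if "1 \<le> j" "j < ?N" "s (Suc j) < s j" for j
      using * that descents_iff[of "s j" "s (Suc j)" ?N s] by blast
    have "odd (s i)" if "1 < i" "s i < s (i - 1)"
      using that i D[of "i - 1"] by auto
    thus "\<not> (1 < i \<and> s i < s (i - 1))" using ev by blast
    show "i < ?N" using * i ev by (cases "i = ?N") auto
    hence "\<not> s (Suc i) < s i" using D[of i] i ev by auto
    thus "s i < s (Suc i)" using neq[of i] by simp
  qed
  also have "\<dots> \<longleftrightarrow> s \<in> Y_star_perms n"
    using s by (simp add: Y_star_perms_def)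
  finally show ?thesis by blast
qed

text \<open>
  Appending the letter \<open>2 * n + 1\<close> to a word of length \<open>2 * n\<close> gives every letter a successor, so that not
  being a descent top is the same as being followed by a larger letter.
\<close>

lemma X_perms_iff:
  assumes s: "s permutes {1..2 * n + 1}"
  defines "w \<equiv> word (2 * n + 1) s"
  shows "s \<in> X_perms n \<longleftrightarrow> s (2 * n + 1) = 2 * n + 1 \<and>
           (\<forall>v\<in>{1..2 * n}. if even v then \<not> follows_larger v w else precedes_larger v w)"
proof (cases "s (2 * n + 1) = 2 * n + 1")
  case False
  hence "\<not> s permutes {1..2 * n}" by (auto dest: permutes_not_in[of s _ "2 * n + 1"])
  thus ?thesis using False by (simp add: X_perms_def)
next
  case True
  let ?N = "2 * n + 1"
  have s': "s permutes {1..2 * n}"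
    using s by (rule permutes_superset) (use True in \<open>auto simp: le_Suc_eq\<close>)
  have neq: "s (Suc i) \<noteq> s i" for i using permutes_inj[OF s] by (simp add: inj_eq)
  have "(\<forall>v\<in>{1..2 * n}. if even v then \<not> follows_larger v w else precedes_larger v w) \<longleftrightarrow>
        (\<forall>i\<in>{1..2 * n}. if even (s i) then \<not> follows_larger (s i) w else precedes_larger (s i) w)"
    by (rule ball_values[OF s'])
  also have "\<dots> \<longleftrightarrow> (\<forall>i\<in>{1..2 * n}. if even (s i) then \<not> (1 < i \<and> s i < s (i - 1)) else s i < s (Suc i))"
    unfolding w_def using follows_larger_word[OF s] precedes_larger_word[OF s] by (intro ball_cong refl) simp
  also have "\<dots> \<longleftrightarrow> (\<forall>(x, z)\<in>descents (2 * n) s. even x \<and> odd z)"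
  proof (intro iffI ballI)
    assume *: "\<forall>i\<in>{1..2 * n}. if even (s i) then \<not> (1 < i \<and> s i < s (i - 1)) else s i < s (Suc i)"
    show "case xz of (x, z) \<Rightarrow> even x \<and> odd z" if "xz \<in> descents (2 * n) s" for xz
    proof -
      from that obtain i where i: "1 \<le> i" "i < 2 * n" "s (Suc i) < s i" "xz = (s i, s (Suc i))"
        by (cases xz) (auto simp: descents_iff)
      thus ?thesis using *[rule_format, of i] *[rule_format, of "Suc i"] by (auto split: if_splits)
    qed
  next
    fix i assume *: "\<forall>(x, z)\<in>descents (2 * n) s. even x \<and> odd z" and i: "i \<in> {1..2 * n}"
    have D: "even (s j) \<and> odd (s (Suc j))" if "1 \<le> j" "j < 2 * n" "s (Suc j) < s j" for j
      using * that descents_iff[of "s j" "s (Suc j)" "2 * n" s] by blast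
    have "s i \<le> 2 * n" using permutes_in_image[OF s', of i] i by simp
    hence "s i < s (Suc i)" if "i = 2 * n" using that True by simp
    hence "even (s i)" if "\<not> s i < s (Suc i)"
      using that i neq[of i] D[of i] by (cases "i = 2 * n") auto
    moreover have "odd (s i)" if "1 < i" "s i < s (i - 1)"
      using that i D[of "i - 1"] by auto
    ultimately show "if even (s i) then \<not> (1 < i \<and> s i < s (i - 1)) else s i < s (Suc i)"
      by auto
  qed
  finally show ?thesis using s' True by (auto simp: X_perms_def)
qed

lemma Y_total_word:
  fixes a p q y t :: "'a :: comm_ring_1"
  assumes s: "s permutes {1..2 * n + 1}"
  shows "Y_total a p q y t (2 * n) (word (2 * n + 1) s) = of_bool (s \<in> Y_star_perms n) *
    (a ^ lema (2 * n + 1) s * p ^ pat_2_13 (2 * n + 1) s * q ^ pat_31_2 (2 * n + 1) s *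
     y ^ dd (2 * n + 1) s * t ^ des (2 * n + 1) s)"
proof -
  let ?N = "2 * n + 1"
  let ?w = "word ?N s"
  have "set ?w \<subseteq> {..?N}" using set_word[OF s] by auto
  note max = max_letter[OF this]
  have stats: "lema ?N s = card {v \<in> {1..2 * n}. even v \<and> lrmax v ?w}"
    "des ?N s = card {v \<in> {1..2 * n}. follows_larger v ?w}"
    "dd ?N s = card {v \<in> {1..2 * n}. follows_larger v ?w \<and> \<not> precedes_larger v ?w}"
    "pat_31_2 ?N s = (\<Sum>v=1..2 * n. falls v (before v ?w))"
    "pat_2_13 ?N s = (\<Sum>v=1..2 * n. rises v (after v ?w))"
    unfolding lema_word[OF s] des_word[OF s] dd_word[OF s] pat_31_2_word[OF s] pat_2_13_word[OF s]
    by - (rule card_drop_max sum_drop_max, use max in simp)+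
  show ?thesis
    unfolding stats Y_star_perms_iff[OF s] Y_total_def Y_weight_def base_weight_def
    by (simp only: prod.distrib prod_of_bool prod_power_of_bool power_sum finite_atLeastAtMost mult_ac)
qed

text \<open>
  A largest letter at the end creates no descent and takes part in no pattern 31-2 or 2-31; being odd, it does
  not count for \<open>lema\<close> either.
\<close>

lemma stats_fix_max:
  assumes s: "s permutes {1..2 * n + 1}" and fix_max: "s (2 * n + 1) = 2 * n + 1"
  shows "des (2 * n) s = des (2 * n + 1) s" "lema (2 * n) s = lema (2 * n + 1) s"
    "pat_31_2 (2 * n) s = pat_31_2 (2 * n + 1) s" "pat_2_31 (2 * n) s = pat_2_31 (2 * n + 1) s"
proof -
  have le: "s i \<le> 2 * n + 1" if "i \<le> 2 * n + 1" for i
    using permutes_in_image[OF s, of i] permutes_not_in[OF s, of i] that by (cases "i = 0") auto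
  have "i \<noteq> 2 * n" if "s i > s (i + 1)" for i
    using that le[of i] fix_max by auto
  hence "1 \<le> i \<and> i < 2 * n \<and> s i > s (i + 1) \<longleftrightarrow> 1 \<le> i \<and> i < 2 * n + 1 \<and> s i > s (i + 1)" for i
    by (metis Suc_eq_plus1 less_SucE less_SucI)
  thus "des (2 * n) s = des (2 * n + 1) s" unfolding des_def descents_def by metis
  have "i \<noteq> 2 * n + 1" if "even (s i)" for i using that fix_max by auto
  hence lema: "1 \<le> i \<and> i \<le> 2 * n \<and> even (s i) \<and> P i \<longleftrightarrow> 1 \<le> i \<and> i \<le> 2 * n + 1 \<and> even (s i) \<and> P i" for i P
    by (metis Suc_eq_plus1 le_SucE le_SucI)
  show "lema (2 * n) s = lema (2 * n + 1) s" unfolding lema_def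
    by (rule arg_cong[of _ _ card], rule Collect_cong, rule ex_cong1, rule conj_cong[OF refl], rule lema)
  have "j \<noteq> 2 * n + 1" if "i < j" "j \<le> 2 * n + 1" "s (i - 1) > s j" for i j
  proof -
    have "s (i - 1) \<le> 2 * n + 1" using that by (intro le) simp
    thus ?thesis using that fix_max by auto
  qed
  hence p312: "2 \<le> i \<and> i < j \<and> j \<le> 2 * n \<and> s (i - 1) > s j \<and> s j > s i \<longleftrightarrow>
         2 \<le> i \<and> i < j \<and> j \<le> 2 * n + 1 \<and> s (i - 1) > s j \<and> s j > s i" for i j
    by (metis Suc_eq_plus1 le_SucE le_SucI)
  show "pat_31_2 (2 * n) s = pat_31_2 (2 * n + 1) s" unfolding pat_31_2_def
    by (rule arg_cong[of _ _ "\<lambda>P. card (Collect (case_prod P))"], intro ext, rule p312)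
  have "j \<noteq> 2 * n" if "i < j" "s i > s (j + 1)" for i j
    using that le[of i] fix_max by auto
  hence p231: "1 \<le> i \<and> i < j \<and> j + 1 \<le> 2 * n \<and> s j > s i \<and> s i > s (j + 1) \<longleftrightarrow>
         1 \<le> i \<and> i < j \<and> j + 1 \<le> 2 * n + 1 \<and> s j > s i \<and> s i > s (j + 1)" for i j
    by (metis Suc_eq_plus1 le_SucE le_SucI add_right_cancel)
  show "pat_2_31 (2 * n) s = pat_2_31 (2 * n + 1) s" unfolding pat_2_31_def
    by (rule arg_cong[of _ _ "\<lambda>P. card (Collect (case_prod P))"], intro ext, rule p231)
qed

lemma dom_count_word:
  assumes s: "s permutes {1..2 * n + 1}" and fix_max: "s (2 * n + 1) = 2 * n + 1"
  defines "w \<equiv> word (2 * n + 1) s"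
  shows "dom_count n s = card {v \<in> {1..2 * n}. even v \<and> \<not> precedes_larger v w \<and> follows_larger (v - 1) w}"
proof -
  let ?N = "2 * n + 1"
  have s': "s permutes {1..2 * n}"
    using s by (rule permutes_superset) (use fix_max in \<open>auto simp: le_Suc_eq\<close>)
  note inj = inj_eq[OF permutes_inj[OF s]]
  have all: "\<forall>v\<in>{1..2 * n}. (v \<in> descent_tops (2 * n) s \<longleftrightarrow> \<not> precedes_larger v w) \<and>
                          (v \<in> descent_bottoms (2 * n) s \<longleftrightarrow> follows_larger v w)"
  proof (subst ball_values[OF s'], rule ballI)
    fix i assume i: "i \<in> {1..2 * n}"
    have "s i \<le> 2 * n" using permutes_in_image[OF s', of i] i by simp
    hence last: "s i < s (Suc i)" if "i = 2 * n" using that fix_max by simp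
    have "s i \<in> descent_tops (2 * n) s \<longleftrightarrow> i < 2 * n \<and> s (Suc i) < s i"
      using i by (auto simp: descent_tops_def descents_def image_iff inj)
    also have "\<dots> \<longleftrightarrow> \<not> (i < ?N \<and> s i < s (Suc i))"
      using i last inj[of i "Suc i"] by (cases "i = 2 * n") auto
    also have "\<dots> \<longleftrightarrow> \<not> precedes_larger (s i) w"
      unfolding w_def using i by (subst precedes_larger_word[OF s]) auto
    finally have tops: "s i \<in> descent_tops (2 * n) s \<longleftrightarrow> \<not> precedes_larger (s i) w" .
    have "s i \<in> descent_bottoms (2 * n) s \<longleftrightarrow> (\<exists>j. 1 \<le> j \<and> j < 2 * n \<and> s (Suc j) < s j \<and> i = Suc j)"
      by (auto simp: descent_bottoms_def descents_def image_iff inj)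
    also have "\<dots> \<longleftrightarrow> 1 < i \<and> s i < s (i - 1)"
      using i by (cases i) auto
    also have "\<dots> \<longleftrightarrow> follows_larger (s i) w" unfolding w_def using i by (subst follows_larger_word[OF s]) auto
    finally show "(s i \<in> descent_tops (2 * n) s \<longleftrightarrow> \<not> precedes_larger (s i) w) \<and>
                  (s i \<in> descent_bottoms (2 * n) s \<longleftrightarrow> follows_larger (s i) w)"
      using tops by blast
  qed
  have *: "2 * j \<in> descent_tops (2 * n) s \<longleftrightarrow> \<not> precedes_larger (2 * j) w"
      "2 * j - 1 \<in> descent_bottoms (2 * n) s \<longleftrightarrow> follows_larger (2 * j - 1) w" if "1 \<le> j" "j \<le> n" for j
  proof -
    have "2 * j \<in> {1..2 * n}" "2 * j - 1 \<in> {1..2 * n}" using that by auto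
    thus "2 * j \<in> descent_tops (2 * n) s \<longleftrightarrow> \<not> precedes_larger (2 * j) w"
      "2 * j - 1 \<in> descent_bottoms (2 * n) s \<longleftrightarrow> follows_larger (2 * j - 1) w"
      using all by blast+
  qed
  have "dom_count n s = card {j. 1 \<le> j \<and> j \<le> n \<and> \<not> precedes_larger (2 * j) w \<and> follows_larger (2 * j - 1) w}"
    unfolding dom_count_def by (rule arg_cong[of _ _ card], rule Collect_cong) (use * in blast)
  also have "\<dots> = card {v \<in> {1..2 * n}. even v \<and> \<not> precedes_larger v w \<and> follows_larger (v - 1) w}"
    by (rule bij_betw_same_card, rule bij_betw_byWitness[where f = "\<lambda>j. 2 * j" and f' = "\<lambda>v. v div 2"]) auto
  finally show ?thesis .
qed

lemma X_total_word:
  fixes a p q y t :: "'a :: comm_ring_1"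
  assumes s: "s permutes {1..2 * n + 1}"
  shows "X_total a p q y t (2 * n + 1) (2 * n) (word (2 * n + 1) s) = of_bool (s \<in> X_perms n) *
    (a ^ lema (2 * n) s * p ^ pat_2_31 (2 * n) s * q ^ pat_31_2 (2 * n) s *
     y ^ dom_count n s * t ^ des (2 * n) s)"
proof -
  let ?N = "2 * n + 1"
  let ?w = "word ?N s"
  have last: "?w \<noteq> [] \<and> last ?w = ?N \<longleftrightarrow> s ?N = ?N"
    by (simp add: word_def)
  show ?thesis
  proof (cases "s ?N = ?N")
    case False
    thus ?thesis unfolding X_total_def last X_perms_iff[OF s] by simp
  next
    case True
    have "set ?w \<subseteq> {..?N}" using set_word[OF s] by auto
    note max = max_letter[OF this]
      have stats: "lema ?N s = card {v \<in> {1..2 * n}. even v \<and> lrmax v ?w}"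
      "des ?N s = card {v \<in> {1..2 * n}. follows_larger v ?w}"
      "pat_31_2 ?N s = (\<Sum>v=1..2 * n. falls v (before v ?w))"
      "pat_2_31 ?N s = (\<Sum>v=1..2 * n. falls v (after v ?w))"
      unfolding lema_word[OF s] des_word[OF s] pat_31_2_word[OF s] pat_2_31_word[OF s]
      by - (rule card_drop_max sum_drop_max, use max in simp)+
    show ?thesis
      unfolding stats_fix_max[OF s True] stats dom_count_word[OF s True] X_perms_iff[OF s]
        X_total_def last X_weight_def base_weight_def
      using True
      by (simp only: prod.distrib prod_of_bool prod_power_of_bool power_sum finite_atLeastAtMost mult_ac
          simp_thms of_bool_eq mult_1_left)
  qed
qed

section \<open>Equality of the two generating functions\<close>

lemma sum_permutes_word:
  fixes F :: "nat list \<Rightarrow> 'a :: comm_ring_1"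
  shows "(\<Sum>s | s permutes {1..2 * n + 1}. F (word (2 * n + 1) s)) =
         (\<Sum>w\<in>configs (2 * n + 1) (2 * n). F w * of_bool (count_list w (2 * n + 1) = 1))"
proof -
  let ?N = "2 * n + 1"
  have "(\<Sum>s | s permutes {1..?N}. F (word ?N s)) = sum F {w. distinct w \<and> set w = {1..?N}}"
    by (rule sum.reindex_bij_betw[OF bij_betw_word])
  also have "{w. distinct w \<and> set w = {1..?N}} = configs ?N (2 * n) \<inter> {w. count_list w ?N = 1}"
    using configs_one_hole_iff[of ?N] by auto
  also have "sum F \<dots> = (\<Sum>w\<in>configs ?N (2 * n). F w * of_bool (count_list w ?N = 1))"
    using finite_configs[of "2 * n" ?N] by (intro sum.mono_neutral_cong_left) auto
  finally show ?thesis .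
qed

theorem theorem17:
  fixes n :: nat and a p q y t :: "'a :: comm_ring_1"
  assumes "n \<ge> 1"
  shows "(\<Sum>s \<in> Y_star_perms n.
            a ^ lema (2 * n + 1) s * p ^ pat_2_13 (2 * n + 1) s * q ^ pat_31_2 (2 * n + 1) s *
            y ^ dd (2 * n + 1) s * t ^ des (2 * n + 1) s) =
         (\<Sum>s \<in> X_perms n.
            a ^ lema (2 * n) s * p ^ pat_2_31 (2 * n) s * q ^ pat_31_2 (2 * n) s *
            y ^ dom_count n s * t ^ des (2 * n) s)"
    (is "sum ?Y _ = sum ?X _")
proof -
  let ?N = "2 * n + 1"
  let ?S = "{s. s permutes {1..?N}}"
  have fin: "finite ?S" by (rule finite_permutations) simp
  have "sum ?Y (Y_star_perms n) = (\<Sum>s\<in>?S. of_bool (s \<in> Y_star_perms n) * ?Y s)"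
    by (rule sum.mono_neutral_cong_left) (use fin in \<open>auto simp: Y_star_perms_def\<close>)
  also have "\<dots> = (\<Sum>s\<in>?S. Y_total a p q y t (2 * n) (word ?N s))"
    by (intro sum.cong refl) (rule Y_total_word[symmetric]; simp)
  also have "\<dots> = (\<Sum>w\<in>configs ?N (2 * n). Y_total a p q y t (2 * n) w * of_bool (count_list w ?N = 1))"
    by (rule sum_permutes_word)
  also have "\<dots> = (\<Sum>w\<in>configs ?N (2 * n). X_total a p q y t ?N (2 * n) w * of_bool (count_list w ?N = 1))"
    by (rule sum_X_total_eq_sum_Y_total[symmetric]) auto
  also have "\<dots> = (\<Sum>s\<in>?S. X_total a p q y t ?N (2 * n) (word ?N s))"
    by (rule sum_permutes_word[symmetric])
  also have "\<dots> = (\<Sum>s\<in>?S. of_bool (s \<in> X_perms n) * ?X s)"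
    by (intro sum.cong refl) (rule X_total_word; simp)
  also have "\<dots> = sum ?X (X_perms n)"
    by (rule sum.mono_neutral_cong_right)
       (use fin in \<open>auto simp: X_perms_def intro: permutes_subset[where S = "{1..2 * n}"]\<close>)
  finally show ?thesis .
qed

end
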